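(* Let $\alpha, x \in \mathbb{R}$ and let $n \ge 0$ be an integer. The higher-order Euler polynomial $E_n^{(\alpha)}(x)$ satisfies $$E_{n}^{(\alpha)}(x)=\sum_{k=0}^{n}\binom{n}{k}\sum_{i=0}^{k}\langle -\alpha\rangle_{i}\,\frac{S(k,i)}{2^{i}}\,x^{n-k}.$$ In particular, the higher-order Euler numbers $E_n^{(\alpha)}=2^nE_n^{(\alpha)}(1/2)$ satisfy $$E_{n}^{(\alpha)}=\sum_{k=0}^{n}\binom{n}{k}\sum_{i=0}^{k}\langle -\alpha\rangle_{i}\,S(k,i)\,2^{k-i}.$$
   Context: The higher-order Euler polynomials $E_n^{(\alpha)}(x)$ are defined by the generating function $$\left(\frac{2}{e^{t}+1}\right)^{\alpha}e^{xt}=\sum_{n=0}^{\infty}E_n^{(\alpha)}(x)\frac{t^n}{n!}$$ for $t$ near $0$, where the power is the branch equal to $1$ at $t=0$. The higher-order Euler numbers are $E_n^{(\alpha)}=2^nE_n^{(\alpha)}(1/2)$. The falling factorial is $\langle y\rangle_0=1$ and $\langle y\rangle_m=y(y-1)\cdots(y-m+1)$ for $m\ge1$, $y\in\mathbb{R}$. $S(n,k)$ denotes the Stirling numbers of the second kind, defined by $\frac{(e^t-1)^k}{k!}=\sum_{n=k}^{\infty}S(n,k)\frac{t^n}{n!}$ (so $S(0,0)=1$ and $S(n,0)=0$ for $n\ge1$). The convention $x^0=1$ (also for $x=0$) is used. *)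

theory Defs
  imports "HOL-Analysis.Analysis" "HOL-Combinatorics.Stirling"
begin

text \<open>
  The value at \<open>n\<close> of the unique real sequence \<open>e\<close> for which
  \<open>(2 / (exp t + 1)) powr \<alpha> * exp (x * t)\<close> is the sum of \<open>e k * t ^ k / k!\<close> for all complex \<open>t\<close>
  in a neighbourhood of 0. There \<open>2 / (exp t + 1)\<close> is close to 1, so the principal power
  is the branch that equals 1 at \<open>t = 0\<close>.
\<close>
definition higher_euler_poly :: "real \<Rightarrow> nat \<Rightarrow> real \<Rightarrow> real" where
  "higher_euler_poly \<alpha> n x =
     (THE e :: nat \<Rightarrow> real.
        (\<lambda>t :: complex. (2 / (exp t + 1)) powr complex_of_real \<alpha> * exp (complex_of_real x * t))
          has_fps_expansion Abs_fps (\<lambda>k. complex_of_real (e k) / fact k)) n"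

definition higher_euler_number :: "real \<Rightarrow> nat \<Rightarrow> real" where
  "higher_euler_number \<alpha> n = 2 ^ n * higher_euler_poly \<alpha> n (1/2)"

definition falling_fact :: "real \<Rightarrow> nat \<Rightarrow> real" where
  "falling_fact y m = (\<Prod>j<m. y - real j)"

text \<open>
  The library defines \<^const>\<open>Stirling\<close> by recursion; it has the usual exponential generating function.
\<close>
lemma Stirling_egf:
  "fps_const (1 / fact k) * (fps_exp 1 - 1) ^ k =
     Abs_fps (\<lambda>n. of_nat (Stirling n k) / fact n :: 'a :: field_char_0)"
proof (induction k)
  case 0
  have "Stirling n 0 = (if n = 0 then 1 else 0)" for n
    by (cases n) auto
  then show ?case by (auto simp: fps_eq_iff)
next
  case (Suc k)
  define A where "A = (fps_const (1 / fact (Suc k)) * (fps_exp 1 - 1) ^ Suc k :: 'a fps)"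
  define B where "B = (Abs_fps (\<lambda>n. of_nat (Stirling n (Suc k)) / fact n) :: 'a fps)"
  define C where "C = (Abs_fps (\<lambda>n. of_nat (Stirling n k) / fact n) :: 'a fps)"
  have C: "C = fps_const (1 / fact k) * (fps_exp 1 - 1) ^ k"
    using Suc by (simp add: C_def)
  have c: "fps_const (1 / fact (Suc k)) * of_nat (Suc k) = (fps_const (1 / fact k) :: 'a fps)"
    unfolding fps_of_nat[symmetric] fps_const_mult by (simp add: field_simps del: of_nat_Suc)
  have "fps_deriv A =
      fps_const (1 / fact (Suc k)) * of_nat (Suc k) * (fps_exp 1 - 1) ^ k * fps_exp 1"
    unfolding A_def fps_deriv_mult fps_deriv_power
    by (simp add: mult_ac fps_of_nat del: of_nat_Suc power_Suc fact_Suc)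
  also have "\<dots> = C * fps_exp 1"
    unfolding c C ..
  finally have "fps_deriv A = C * (fps_exp 1 - 1) + C"
    by (simp add: algebra_simps)
  also have "C * (fps_exp 1 - 1) = of_nat (Suc k) * A"
    unfolding C c[symmetric] A_def by (simp add: mult_ac)
  finally have dA: "fps_deriv A = of_nat (Suc k) * A + C" .
  have dB: "fps_deriv B = of_nat (Suc k) * B + C"
    by (simp add: fps_eq_iff B_def C_def fps_of_nat[symmetric] field_simps del: of_nat_Suc)
       (simp add: field_simps)
  have A0: "fps_nth A 0 = fps_nth B 0"
    by (simp add: A_def B_def)
  have "fps_nth A n = fps_nth B n" for n
  proof (induction n)
    case (Suc n)
    have "of_nat (Suc n) * fps_nth A (Suc n) = of_nat (Suc n) * fps_nth B (Suc n)"
      using arg_cong[OF dA, of "\<lambda>F. fps_nth F n"] arg_cong[OF dB, of "\<lambda>F. fps_nth F n"] Suc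
      by (simp add: fps_of_nat[symmetric] del: of_nat_Suc)
    then show ?case by (simp del: of_nat_Suc)
  qed (fact A0)
  then show ?case by (simp add: A_def B_def fps_eq_iff)
qed

end

theory Submission
  imports Defs "HOL-Complex_Analysis.Laurent_Convergence"
begin

text \<open>
  Since \<open>2 / (exp t + 1) = inverse (1 + (exp t - 1) / 2)\<close>, its power with exponent \<open>\<alpha>\<close> is the
  binomial series with exponent \<open>- \<alpha>\<close> composed with \<open>(exp t - 1) / 2\<close>, and the coefficients of the
  powers of \<open>exp t - 1\<close> are Stirling numbers. Multiplying by \<open>exp (x * t)\<close> is a binomial convolution.
\<close>

text \<open>A power series expansion at 0 is unique, and the coefficients determine \<open>e\<close>
  because \<open>complex_of_real\<close> is injective and factorials are nonzero. So exhibiting one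
  such sequence evaluates the \<open>THE\<close>.\<close>

lemma higher_euler_poly_eqI:
  assumes "(\<lambda>t::complex. (2 / (exp t + 1)) powr complex_of_real \<alpha> * exp (complex_of_real x * t))
             has_fps_expansion Abs_fps (\<lambda>k. complex_of_real (e k) / fact k)"
  shows "higher_euler_poly \<alpha> n x = e n"
proof -
  have unique: "d = e" if
    "(\<lambda>t::complex. (2 / (exp t + 1)) powr complex_of_real \<alpha> * exp (complex_of_real x * t))
       has_fps_expansion Abs_fps (\<lambda>k. complex_of_real (d k) / fact k)" for d
    using fps_expansion_unique_complex[OF that assms] by (auto simp: fps_eq_iff)
  show ?thesis
    unfolding higher_euler_poly_def
    by (rule fun_cong[of _ e n], rule the_equality, rule assms, rule unique)
qed

text \<open>Off the branch cut \<open>Ln (inverse z) = - Ln z\<close>. On the negative real axis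
  this fails: both logarithms have imaginary part pi.\<close>

lemma powr_inverse_complex:
  fixes z a :: complex
  assumes "z \<notin> \<real>\<^sub>\<le>\<^sub>0"
  shows "inverse z powr a = z powr (- a)"
proof -
  have "z \<noteq> 0"
    using assms by auto
  with assms show ?thesis
    by (simp add: powr_def Ln_inverse)
qed

lemma has_fps_expansion_two_div_exp_plus_one_powr:
  fixes a :: complex
  shows "(\<lambda>t. (2 / (exp t + 1)) powr a) has_fps_expansion
           (fps_binomial (- a) oo (fps_const (1/2) * (fps_exp 1 - 1)))"
proof -
  define g :: "complex \<Rightarrow> complex" where "g t = 1/2 * (exp t - 1)" for t
  have g: "g has_fps_expansion fps_const (1/2) * (fps_exp 1 - 1)"
    unfolding g_def by (intro fps_expansion_intros)
  have comp: "((\<lambda>z. (1 + z) powr (- a)) \<circ> g) has_fps_expansion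
      (fps_binomial (- a) oo (fps_const (1/2) * (fps_exp 1 - 1)))"
    by (intro has_fps_expansion_compose has_fps_expansion_binomial_complex g) simp
  \<comment> \<open>Since \<open>g 0 = 0\<close>, the value \<open>1 + g t\<close> stays in the
    right half-plane for t near 0, hence off the branch cut.\<close>
  have "open {t. 0 < Re (1 + g t)}"
    unfolding g_def by (intro open_Collect_less continuous_intros)
  then have "eventually (\<lambda>t. t \<in> {t. 0 < Re (1 + g t)}) (nhds 0)"
    by (intro eventually_nhds_in_open) (simp_all add: g_def)
  then have "eventually (\<lambda>t. ((\<lambda>z. (1 + z) powr (- a)) \<circ> g) t = (2 / (exp t + 1)) powr a) (nhds 0)"
  proof eventually_elim
    case (elim t)
    then have "1 + g t \<notin> \<real>\<^sub>\<le>\<^sub>0"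
      by (auto simp: complex_nonpos_Reals_iff)
    moreover have "2 / (exp t + 1) = inverse (1 + g t)"
      by (simp add: g_def field_simps)
    ultimately show ?case
      by (simp add: powr_inverse_complex)
  qed
  from has_fps_expansion_cong[OF this refl] comp show ?thesis
    by (rule iffD1)
qed

lemma gbinomial_falling_fact:
  "(complex_of_real y gchoose i) = complex_of_real (falling_fact y i) / fact i"
  by (simp add: gbinomial_prod_rev falling_fact_def atLeast0LessThan)

lemma fps_exp_minus_one_power_nth:
  "fps_nth ((fps_exp 1 - 1) ^ k) n = fact k * of_nat (Stirling n k) / (fact n :: 'a :: field_char_0)"
proof -
  have "fps_nth (fps_const (1 / fact k) * (fps_exp 1 - 1) ^ k) n =
      (of_nat (Stirling n k) / fact n :: 'a)"
    unfolding Stirling_egf by simp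
  then show ?thesis
    by (simp add: field_simps)
qed

text \<open>The \<open>fact i\<close> in the coefficient of \<open>(fps_exp 1 - 1) ^ i\<close>
  cancels the denominator of \<open>y gchoose i\<close>. The sum stops at \<open>k\<close> because
  the inner series has no constant term.\<close>

lemma fps_binomial_compose_exp_nth:
  "fps_nth (fps_binomial (complex_of_real y) oo (fps_const (1/2) * (fps_exp 1 - 1))) k =
     complex_of_real (\<Sum>i=0..k. falling_fact y i * (real (Stirling k i) / 2 ^ i)) / fact k"
  unfolding fps_compose_nth of_real_sum sum_divide_distrib
  by (intro sum.cong refl)
     (simp add: power_mult_distrib fps_const_power gbinomial_falling_fact
        fps_exp_minus_one_power_nth power_one_over)

lemma higher_euler_poly_eq:
  "higher_euler_poly \<alpha> n x =
     (\<Sum>k=0..n. real (n choose k) *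
       (\<Sum>i=0..k. falling_fact (- \<alpha>) i * (real (Stirling k i) / 2 ^ i)) * x ^ (n - k))"
\<comment> \<open>Here \<open>e\<close> is the right-hand side as a function of \<open>n\<close>, so
  all coefficients are matched at once.\<close>
proof (rule higher_euler_poly_eqI)
  let ?B = "fps_binomial (- complex_of_real \<alpha>) oo (fps_const (1/2) * (fps_exp 1 - 1))"
  define c where "c k = (\<Sum>i=0..k. falling_fact (- \<alpha>) i * (real (Stirling k i) / 2 ^ i))" for k
  have B: "fps_nth ?B k = complex_of_real (c k) / fact k" for k
    using fps_binomial_compose_exp_nth[of "- \<alpha>" k] by (simp add: c_def)
  \<comment> \<open>In the Cauchy product, 1 / (k! (m - k)!) equals \<open>m choose k\<close>
    divided by m!.\<close>
  have "fps_nth (?B * fps_exp (complex_of_real x)) m =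
      complex_of_real (\<Sum>k=0..m. real (m choose k) * c k * x ^ (m - k)) / fact m" for m
    unfolding fps_mult_nth B of_real_sum sum_divide_distrib
    by (intro sum.cong refl) (simp add: binomial_fact)
  then have "?B * fps_exp (complex_of_real x) =
      Abs_fps (\<lambda>m. complex_of_real (\<Sum>k=0..m. real (m choose k) * c k * x ^ (m - k)) / fact m)"
    by (simp add: fps_eq_iff)
  then show "(\<lambda>t. (2 / (exp t + 1)) powr complex_of_real \<alpha> * exp (complex_of_real x * t))
      has_fps_expansion Abs_fps (\<lambda>m. complex_of_real (\<Sum>k=0..m. real (m choose k) *
        (\<Sum>i=0..k. falling_fact (- \<alpha>) i * (real (Stirling k i) / 2 ^ i)) * x ^ (m - k)) / fact m)"
    using has_fps_expansion_mult[OF has_fps_expansion_two_div_exp_plus_one_powr[of "complex_of_real \<alpha>"]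
        has_fps_expansion_exp[of "complex_of_real x"]]
    unfolding c_def by (simp only:)
qed

theorem theorem3p3:
  fixes \<alpha> x :: real and n :: nat
  shows "higher_euler_poly \<alpha> n x =
           (\<Sum>k=0..n. real (n choose k) *
             (\<Sum>i=0..k. falling_fact (- \<alpha>) i * (real (Stirling k i) / 2 ^ i)) * x ^ (n - k)) \<and>
         higher_euler_number \<alpha> n =
           (\<Sum>k=0..n. real (n choose k) *
             (\<Sum>i=0..k. falling_fact (- \<alpha>) i * real (Stirling k i) * 2 ^ (k - i)))"
proof
  show "higher_euler_number \<alpha> n =
      (\<Sum>k=0..n. real (n choose k) *
        (\<Sum>i=0..k. falling_fact (- \<alpha>) i * real (Stirling k i) * 2 ^ (k - i)))"
    \<comment> \<open>At x = 1/2 the factor 2^n (1/2)^(n - k) is 2^k, and 2^k / 2^i = 2^(k - i)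
      because i \<le> k.\<close>
    unfolding higher_euler_number_def higher_euler_poly_eq sum_distrib_left sum_distrib_right
    by (intro sum.cong refl) (simp add: power_diff power_one_over)
qed (rule higher_euler_poly_eq)

end
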